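(* We have $$\sum_{k=1}^\infty \frac{16^k}{k^3 \binom{2k}{k}^3} \left( (6k-2) H_{k-1}^{(2)} + \frac{1}{k} \right) = \frac{\pi^4}{24}.$$
   Context: For integers $m\ge1$ and $n\ge0$, $H_n^{(m)}=\sum_{0<j\le n}\frac1{j^m}$ denotes the harmonic number of order $m$ (so $H_0^{(m)}=0$). *)

theory Defs
  imports "HOL-Analysis.Analysis"
begin

text \<open>
  The harmonic number of order \<open>m\<close>; the first argument is the order, the second the upper
  summation limit. For \<open>m = 1\<close> it is the library's \<open>harm\<close>.
\<close>

definition harm_ord :: "nat \<Rightarrow> nat \<Rightarrow> real" where
  "harm_ord m n = (\<Sum>j=1..n. 1 / real j ^ m)"

end

theory Submission
  imports Defs "HOL-Real_Asymp.Real_Asymp"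
begin

text \<open>
  The series is the value at \<open>c = 1/2\<close> of a family \<open>U(c)\<close>, obtained by replacing two of the three
  factors \<open>(1/2)\<^sub>k\<close> hidden in \<open>binomial(2k, k)\<^sup>3\<close> by \<open>(c)\<^sub>k\<close>
  and \<open>6 k - 2\<close> by \<open>6 k - 4 + 4 c\<close>. The point of the deformation is that \<open>U\<close> and
  the companion \<open>V\<close> without harmonic numbers change in a very simple way under \<open>c \<mapsto> c + 1\<close>:
  \<open>V(c) - V(c + 1) = 1/c\<^sup>2\<close> and \<open>U(c) - U(c + 1) = V(c + 1)/c\<^sup>2\<close>, and both tend to \<open>0\<close> as \<open>c\<close> grows. So,
  with \<open>c\<^sub>m = m + 1/2\<close>, \<open>V(1/2)\<close> is the sum of all \<open>1/c\<^sub>m\<^sup>2\<close>, while \<open>U(1/2)\<close> is the sum of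
  \<open>1/(c\<^sub>m\<^sup>2 c\<^sub>n\<^sup>2)\<close> over \<open>m < n\<close>. These are the first two elementary symmetric functions of the numbers
  \<open>1/c\<^sub>m\<^sup>2\<close>, and they can be read off from Euler's product: the product of the factors
  \<open>1 - x\<^sup>2/c\<^sub>m\<^sup>2\<close> is \<open>cos (\<pi> x)\<close>, whose coefficient of \<open>x\<^sup>4\<close> is \<open>\<pi>\<^sup>4/24\<close>.

  The two difference relations come from a Wilf--Zeilberger pair. The term of \<open>V(c)\<close> minus that of
  \<open>V(c + 1)\<close> telescopes in the summation index (\<open>V_term_diff\<close>). Multiplying that relation by
  twice the harmonic number at \<open>k - 1\<close> and summing by parts costs an extra term from
  the increment \<open>1/k\<^sup>2\<close> of the harmonic number; the summand \<open>1/k\<close> in the theorem is exactly what turns this extra term into the term of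
  \<open>V(c + 1)/c\<^sup>2\<close> (\<open>U_term_diff\<close>).

  The comparison with the cosine never mentions the symmetric functions: the two relations say that
  the polynomial \<open>1 - V(c) x\<^sup>2 + U(c) x\<^sup>4\<close> equals \<open>1 - x\<^sup>2/c\<^sup>2\<close> times the same polynomial at \<open>c + 1\<close>, up to
  a multiple of \<open>x\<^sup>6\<close> (\<open>quartic_step\<close>). Iterating from \<open>c = 1/2\<close> shows that the polynomial there differs
  from \<open>cos (\<pi> x)\<close> by \<open>O(x\<^sup>6)\<close>, which determines its coefficients.
\<close>

section \<open>The deformed series and its telescoping relations\<close>

text \<open>
  Indices start at \<open>0\<close>, so \<open>i\<close> stands for \<open>k - 1\<close> throughout. At \<open>c = 1/2\<close> the weight is
  \<open>16\<^sup>k/(k\<^sup>3 binomial(2k, k)\<^sup>3)\<close>, by \<open>wt_half\<close> below.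
\<close>

definition wt :: "real \<Rightarrow> nat \<Rightarrow> real" where
  "wt c i = fact i ^ 3 / (pochhammer (1/2) (Suc i) * 4 ^ Suc i * pochhammer c (Suc i) ^ 2)"

definition V_term :: "real \<Rightarrow> nat \<Rightarrow> real" where
  "V_term c i = wt c i * (3 * real (Suc i) - 2 + 2 * c)"

definition U_term :: "real \<Rightarrow> nat \<Rightarrow> real" where
  "U_term c i = wt c i *
     (2 * (3 * real (Suc i) - 2 + 2 * c) * harm_ord 2 i + 1 / real (Suc i))"

text \<open>
  The Wilf--Zeilberger companion of \<open>V_term\<close> in the direction of \<open>c\<close>.
\<close>

definition cert :: "real \<Rightarrow> nat \<Rightarrow> real" where
  "cert c i = wt c i * (4 * real (Suc i) - 2)"

lemma wt_0: "wt c 0 = 1 / (2 * c\<^sup>2)"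
  by (simp add: wt_def)

lemma wt_pos: "c > 0 \<Longrightarrow> wt c i > 0"
  unfolding wt_def by (intro divide_pos_pos mult_pos_pos zero_less_power pochhammer_pos) auto

lemma wt_Suc:
  "wt c (Suc i) =
    wt c i * (real (Suc i) ^ 3 / ((4 * real (Suc i) + 2) * (c + real (Suc i))\<^sup>2))"
proof -
  have regroup: "(r * f) ^ 3 / (Q * (1/2 + r) * (4 * E) * (P * t)\<^sup>2)
      = f ^ 3 / (Q * E * P\<^sup>2) * (r ^ 3 / ((4 * r + 2) * t\<^sup>2))" for r f Q E P t :: real
    unfolding times_divide_times_eq
    by (intro arg_cong2[where f = "(/)"]) (simp_all add: algebra_simps power_mult_distrib)
  have "pochhammer c (Suc (Suc i)) = pochhammer c (Suc i) * (c + real (Suc i))"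
    "pochhammer (1/2::real) (Suc (Suc i)) = pochhammer (1/2) (Suc i) * (1/2 + real (Suc i))"
    "(fact (Suc i) :: real) = real (Suc i) * fact i" "(4::real) ^ Suc (Suc i) = 4 * 4 ^ Suc i"
    by (simp_all only: pochhammer_Suc fact_Suc of_nat_mult power_Suc)
  thus ?thesis unfolding wt_def by (simp only: regroup)
qed

lemma wt_shift:
  assumes "c > 0"
  shows "wt (c + 1) i = wt c i * (c\<^sup>2 / (c + real (Suc i))\<^sup>2)"
proof -
  have "pochhammer c (Suc (Suc i)) = c * pochhammer (c + 1) (Suc i)"
    by (rule pochhammer_rec)
  moreover have "pochhammer c (Suc (Suc i)) = pochhammer c (Suc i) * (c + real (Suc i))"
    by (simp only: pochhammer_Suc)
  ultimately have "pochhammer (c + 1) (Suc i) = pochhammer c (Suc i) * (c + real (Suc i)) / c"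
    using assms by (simp add: field_simps del: pochhammer_Suc)
  moreover have "pochhammer c (Suc i) \<noteq> 0" "c + real (Suc i) \<noteq> 0"
    using assms pochhammer_pos[of c "Suc i"] by auto
  ultimately show ?thesis
    using assms unfolding wt_def
    by (simp add: power_mult_distrib power_divide del: pochhammer_Suc of_nat_Suc power_Suc)
qed

lemma harm_ord_Suc: "harm_ord m (Suc n) = harm_ord m n + 1 / real (Suc n) ^ m"
  by (simp add: harm_ord_def)

text \<open>
  Both \<open>wt c (Suc i)\<close> and \<open>wt (c + 1) i\<close> are rational multiples of \<open>wt c i\<close>. After cancelling it, what remains is an identity of rational functions in \<open>c\<close> and \<open>k\<close>.
\<close>

lemma V_term_diff:
  assumes "c > 0"
  shows "V_term c i - V_term (c + 1) i = cert c i - cert c (Suc i)"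
proof -
  define j where "j = real (Suc i)"
  have j: "j > 0" "real (Suc (Suc i)) = j + 1" by (simp_all add: j_def)
  have nz: "c + j \<noteq> 0" "4 * j + 2 \<noteq> 0" using assms j by auto
  have "(3 * j - 2 + 2 * c) - c\<^sup>2 / (c + j)\<^sup>2 * (3 * j - 2 + 2 * (c + 1))
      = (4 * j - 2) - j ^ 3 / ((4 * j + 2) * (c + j)\<^sup>2) * (4 * (j + 1) - 2)"
    using nz by (simp add: divide_simps) (simp add: algebra_simps power2_eq_square power3_eq_cube)
  hence "wt c i * ((3 * j - 2 + 2 * c) - c\<^sup>2 / (c + j)\<^sup>2 * (3 * j - 2 + 2 * (c + 1)))
      = wt c i * ((4 * j - 2) - j ^ 3 / ((4 * j + 2) * (c + j)\<^sup>2) * (4 * (j + 1) - 2))"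
    by simp
  thus ?thesis
    unfolding V_term_def cert_def wt_shift[OF assms] wt_Suc j(2) j_def[symmetric]
    by (simp add: right_diff_distrib mult.assoc)
qed

text \<open>
  Summation by parts: with \<open>H\<close> for the harmonic number at \<open>k - 1\<close>, the term \<open>2 H (cert c i - cert c (Suc i))\<close>
  supplied by \<open>V_term_diff\<close> exceeds the telescoping difference by \<open>2/k\<^sup>2 * cert c (Suc i)\<close>. The
  contribution \<open>1/k\<close> of \<open>U_term\<close> changes by \<open>wt c i * (k + 2 c)/(c + k)\<^sup>2\<close>, and the two together give
  \<open>wt c i * (3 k + 2 c)/(c + k)\<^sup>2\<close>, which is the term of \<open>V\<close> at \<open>c + 1\<close> divided by \<open>c\<^sup>2\<close>.
\<close>

lemma U_term_diff:
  assumes "c > 0"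
  shows "U_term c i - U_term (c + 1) i = V_term (c + 1) i / c\<^sup>2
           + (2 * harm_ord 2 i * cert c i - 2 * harm_ord 2 (Suc i) * cert c (Suc i))"
proof -
  define j where "j = real (Suc i)"
  have j: "j > 0" "real (Suc (Suc i)) = j + 1" by (simp_all add: j_def)
  have nz: "c + j \<noteq> 0" "4 * j + 2 \<noteq> 0" using assms j by auto
  have cert_next: "cert c (Suc i) = wt c i * (j ^ 3 / (c + j)\<^sup>2)"
    unfolding cert_def wt_Suc j(2) j_def[symmetric]
    using nz by (simp add: divide_simps)
  have "U_term c i - U_term (c + 1) i
      = 2 * harm_ord 2 i * (V_term c i - V_term (c + 1) i)
        + (wt c i - wt (c + 1) i) / j"
    unfolding U_term_def V_term_def j_def by (simp add: algebra_simps diff_divide_distrib)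
  also have "(wt c i - wt (c + 1) i) / j = wt c i * ((j + 2 * c) / (c + j)\<^sup>2)"
    unfolding wt_shift[OF assms] j_def[symmetric] using nz j(1)
    by (simp add: divide_simps) (simp add: algebra_simps power2_eq_square)
  also have "\<dots> = V_term (c + 1) i / c\<^sup>2 - 2 / j\<^sup>2 * cert c (Suc i)"
    unfolding V_term_def wt_shift[OF assms] cert_next j_def[symmetric]
    using nz j(1) assms
    by (simp add: divide_simps) (simp add: algebra_simps power2_eq_square power3_eq_cube)
  finally show ?thesis
    unfolding V_term_diff[OF assms] harm_ord_Suc j_def by (simp add: algebra_simps)
qed

section \<open>Convergence\<close>

text \<open>
  The quotient of consecutive weights is at most \<open>1/4\<close>, because \<open>4 k\<^sup>3 \<le> (4 k + 2) (c + k)\<^sup>2\<close>. The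
  factor \<open>1/c\<^sup>2\<close> from the first weight is kept since it makes the sums vanish as \<open>c\<close> grows.
\<close>

lemma wt_le:
  assumes "c > 0"
  shows "wt c i \<le> (1/4) ^ i / (2 * c\<^sup>2)"
proof (induction i)
  case 0
  show ?case by (simp add: wt_0)
next
  case (Suc i)
  define j where "j = real (Suc i)"
  have j: "j > 0" by (simp add: j_def)
  have "4 * (j * j\<^sup>2) \<le> (4 * j + 2) * (c + j)\<^sup>2"
    using assms j mult_mono[of "4 * j" "4 * j + 2" "j\<^sup>2" "(c + j)\<^sup>2"]
    by (simp add: power_mono)
  hence "j ^ 3 / ((4 * j + 2) * (c + j)\<^sup>2) \<le> 1/4"
    using assms j by (simp add: divide_simps power3_eq_cube power2_eq_square mult.assoc)
  hence "wt c (Suc i) \<le> wt c i * (1/4)"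
    unfolding wt_Suc j_def[symmetric]
    using wt_pos[OF assms, of i] by (intro mult_left_mono) auto
  also have "\<dots> \<le> (1/4) ^ i / (2 * c\<^sup>2) * (1/4)"
    using Suc.IH by (intro mult_right_mono) auto
  finally show ?case by simp
qed

definition majorant :: "nat \<Rightarrow> real" where
  "majorant i = (real i + 1)\<^sup>2 * (1/4) ^ i"

lemma summable_majorant: "summable majorant"
proof (rule summable_comparison_test_bigo)
  show "summable (\<lambda>i. norm ((1/2::real) ^ i))" by (simp add: summable_geometric)
  show "majorant \<in> O(\<lambda>i. (1/2) ^ i)" unfolding majorant_def by real_asymp
qed

lemma wt_times_le:
  assumes "c > 0" "y \<le> a * (real i + 1)\<^sup>2" "0 \<le> y"
  shows "wt c i * y \<le> a / (2 * c\<^sup>2) * majorant i"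
proof -
  have "wt c i * y \<le> (1/4) ^ i / (2 * c\<^sup>2) * (a * (real i + 1)\<^sup>2)"
    using assms wt_le[OF assms(1), of i] wt_pos[OF assms(1), of i]
    by (intro mult_mono) auto
  thus ?thesis by (simp add: majorant_def field_simps)
qed

lemma harm_ord_nonneg: "harm_ord m n \<ge> 0"
  by (simp add: harm_ord_def sum_nonneg)

lemma harm_ord_le: "harm_ord m n \<le> real n"
proof -
  have "harm_ord m n \<le> (\<Sum>j=1..n. 1)"
    unfolding harm_ord_def
  proof (intro sum_mono)
    fix j assume "j \<in> {1..n}"
    hence "1 \<le> real j ^ m" by (intro one_le_power) auto
    with \<open>j \<in> {1..n}\<close> show "1 / real j ^ m \<le> 1" by (simp add: divide_le_eq_1)
  qed
  thus ?thesis by simp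
qed

lemma V_term_bounds:
  assumes "c \<ge> 1/2"
  shows "0 \<le> V_term c i" "V_term c i \<le> 4 / c * majorant i"
proof -
  have c: "c > 0" using assms by simp
  have nn: "0 \<le> 3 * real (Suc i) - 2 + 2 * c" using assms by simp
  show "0 \<le> V_term c i" unfolding V_term_def using nn wt_pos[OF c, of i] by simp
  \<comment> \<open>As \<open>2 c \<ge> 1\<close>, the part without \<open>c\<close> can be absorbed into a multiple of \<open>c\<close>; one of the two
    powers of \<open>c\<close> in the denominator survives.\<close>
  have "1 * (3 * real i + 1) \<le> 2 * c * (3 * real i + 1)"
    using assms by (intro mult_right_mono) auto
  hence "3 * real (Suc i) - 2 + 2 * c \<le> 8 * c * (real i + 1)"
    using c by (simp add: algebra_simps)
  also have "\<dots> \<le> 8 * c * (real i + 1)\<^sup>2"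
    using c by (intro mult_left_mono) (simp_all add: power2_eq_square algebra_simps)
  finally have "V_term c i \<le> 8 * c / (2 * c\<^sup>2) * majorant i"
    unfolding V_term_def using c nn by (intro wt_times_le)
  also have "8 * c / (2 * c\<^sup>2) = 4 / c" using c by (simp add: power2_eq_square)
  finally show "V_term c i \<le> 4 / c * majorant i" .
qed

lemma U_term_bounds:
  assumes "c \<ge> 1/2"
  shows "0 \<le> U_term c i" "U_term c i \<le> 10 / c * majorant i"
proof -
  have c: "c > 0" using assms by simp
  define l where "l = 3 * real (Suc i) - 2 + 2 * c"
  define h where "h = harm_ord 2 i"
  have l: "0 \<le> l" using assms by (simp add: l_def)
  have h: "0 \<le> h" "h \<le> real i + 1"
    using harm_ord_nonneg[of 2 i] harm_ord_le[of 2 i] by (simp_all add: h_def)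
  have nn: "0 \<le> 2 * l * h + 1 / real (Suc i)" using l h by simp
  show "0 \<le> U_term c i"
    unfolding U_term_def using nn wt_pos[OF c, of i] by (simp add: l_def h_def)
  have "1 * (3 * real i + 1) \<le> 2 * c * (3 * real i + 1)"
    using assms by (intro mult_right_mono) auto
  hence "l \<le> 8 * c * (real i + 1)"
    using c by (simp add: algebra_simps l_def)
  hence "l * h \<le> (8 * c * (real i + 1)) * (real i + 1)"
    using l h c by (intro mult_mono) auto
  hence "l * h \<le> 8 * (c * (real i + 1)\<^sup>2)" by (simp add: power2_eq_square mult.assoc)
  moreover have "1 / real (Suc i) \<le> 1" by simp
  moreover have "1 * 1 \<le> (2 * c) * (real i + 1)\<^sup>2"
    using assms by (intro mult_mono) (auto simp: power2_eq_square algebra_simps)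
  ultimately have "2 * l * h + 1 / real (Suc i) \<le> 20 * c * (real i + 1)\<^sup>2"
    unfolding mult.assoc by linarith
  hence "U_term c i \<le> 20 * c / (2 * c\<^sup>2) * majorant i"
    unfolding U_term_def using c nn by (intro wt_times_le) (simp_all add: l_def h_def)
  also have "20 * c / (2 * c\<^sup>2) = 10 / c" using c by (simp add: power2_eq_square)
  finally show "U_term c i \<le> 10 / c * majorant i" .
qed

lemma cert_tendsto_0:
  assumes "c > 0"
  shows "cert c \<longlonglongrightarrow> 0" "(\<lambda>i. 2 * harm_ord 2 i * cert c i) \<longlonglongrightarrow> 0"
proof -
  have maj: "(\<lambda>i. a * majorant i) \<longlonglongrightarrow> 0" for a
    using tendsto_mult_right_zero[OF summable_LIMSEQ_zero[OF summable_majorant]] .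
  have nn: "0 \<le> cert c i" for i
    unfolding cert_def using wt_pos[OF assms, of i] by simp
  have sq: "real i + 1 \<le> (real i + 1)\<^sup>2" for i by (simp add: power2_eq_square algebra_simps)
  have "cert c i \<le> 4 / (2 * c\<^sup>2) * majorant i" for i
    unfolding cert_def using assms sq[of i] by (intro wt_times_le) auto
  with nn show "cert c \<longlonglongrightarrow> 0"
    by (intro tendsto_sandwich[OF _ _ tendsto_const maj[of "4 / (2 * c\<^sup>2)"]]) auto
  have bound: "2 * harm_ord 2 i * cert c i \<le> 8 / (2 * c\<^sup>2) * majorant i" for i
  proof -
    have h: "0 \<le> harm_ord 2 i" "harm_ord 2 i \<le> real i + 1"
      using harm_ord_nonneg[of 2 i] harm_ord_le[of 2 i] by simp_all
    hence "2 * harm_ord 2 i * (4 * real (Suc i) - 2) \<le> 2 * (real i + 1) * (4 * (real i + 1))"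
      by (intro mult_mono) auto
    also have "\<dots> = 8 * (real i + 1)\<^sup>2" by (simp add: power2_eq_square algebra_simps)
    finally have "wt c i * (2 * harm_ord 2 i * (4 * real (Suc i) - 2)) \<le> 8 / (2 * c\<^sup>2) * majorant i"
      using assms h by (intro wt_times_le) auto
    thus ?thesis by (simp add: cert_def mult_ac)
  qed
  show "(\<lambda>i. 2 * harm_ord 2 i * cert c i) \<longlonglongrightarrow> 0"
    using nn harm_ord_nonneg bound
    by (intro tendsto_sandwich[OF _ _ tendsto_const maj[of "8 / (2 * c\<^sup>2)"]])
       (auto intro!: always_eventually mult_nonneg_nonneg)
qed

definition V_sum :: "real \<Rightarrow> real" where
  "V_sum c = suminf (V_term c)"

definition U_sum :: "real \<Rightarrow> real" where
  "U_sum c = suminf (U_term c)"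

lemma V_term_sums: "c \<ge> 1/2 \<Longrightarrow> V_term c sums V_sum c"
  unfolding V_sum_def using V_term_bounds[of c]
  by (intro summable_sums summable_comparison_test'[OF summable_mult[OF summable_majorant], of 0 _ "4 / c"]) auto

lemma U_term_sums: "c \<ge> 1/2 \<Longrightarrow> U_term c sums U_sum c"
  unfolding U_sum_def using U_term_bounds[of c]
  by (intro summable_sums summable_comparison_test'[OF summable_mult[OF summable_majorant], of 0 _ "10 / c"]) auto

lemma V_sum_bounds:
  assumes "c \<ge> 1/2"
  shows "0 \<le> V_sum c" "V_sum c \<le> 4 / c * suminf majorant"
  using sums_le[OF V_term_bounds(1)[OF assms] sums_zero V_term_sums[OF assms]]
    sums_le[OF V_term_bounds(2)[OF assms] V_term_sums[OF assms]
      sums_mult[OF summable_sums[OF summable_majorant]]] by auto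

lemma U_sum_bounds:
  assumes "c \<ge> 1/2"
  shows "0 \<le> U_sum c" "U_sum c \<le> 10 / c * suminf majorant"
  using sums_le[OF U_term_bounds(1)[OF assms] sums_zero U_term_sums[OF assms]]
    sums_le[OF U_term_bounds(2)[OF assms] U_term_sums[OF assms]
      sums_mult[OF summable_sums[OF summable_majorant]]] by auto

lemma V_sum_rec:
  assumes "c \<ge> 1/2"
  shows "V_sum c = V_sum (c + 1) + 1 / c\<^sup>2"
proof -
  have c: "c > 0" using assms by simp
  have "(\<lambda>i. cert c i - cert c (Suc i)) sums (cert c 0 - 0)"
    by (intro telescope_sums' cert_tendsto_0 c)
  hence "(\<lambda>i. V_term c i - V_term (c + 1) i) sums (1 / c\<^sup>2)"
    using c by (simp add: V_term_diff cert_def wt_0)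
  moreover have "(\<lambda>i. V_term c i - V_term (c + 1) i) sums (V_sum c - V_sum (c + 1))"
    using assms by (intro sums_diff V_term_sums) auto
  ultimately show ?thesis using sums_unique2 by fastforce
qed

lemma U_sum_rec:
  assumes "c \<ge> 1/2"
  shows "U_sum c = U_sum (c + 1) + V_sum (c + 1) / c\<^sup>2"
proof -
  have c: "c > 0" using assms by simp
  have "(\<lambda>i. 2 * harm_ord 2 i * cert c i - 2 * harm_ord 2 (Suc i) * cert c (Suc i))
          sums (2 * harm_ord 2 0 * cert c 0 - 0)"
    by (rule telescope_sums'[OF cert_tendsto_0(2)[OF c]])
  hence "(\<lambda>i. V_term (c + 1) i / c\<^sup>2
            + (2 * harm_ord 2 i * cert c i - 2 * harm_ord 2 (Suc i) * cert c (Suc i)))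
          sums (V_sum (c + 1) / c\<^sup>2 + 0)"
    using assms by (intro sums_add sums_divide V_term_sums) (auto simp: harm_ord_def)
  hence "(\<lambda>i. U_term c i - U_term (c + 1) i) sums (V_sum (c + 1) / c\<^sup>2)"
    using c by (simp add: U_term_diff)
  moreover have "(\<lambda>i. U_term c i - U_term (c + 1) i) sums (U_sum c - U_sum (c + 1))"
    using assms by (intro sums_diff U_term_sums) auto
  ultimately show ?thesis using sums_unique2 by fastforce
qed

section \<open>The Euler product of the cosine\<close>

definition cos_prod :: "real \<Rightarrow> nat \<Rightarrow> real" where
  "cos_prod x M = (\<Prod>m<M. 1 - x\<^sup>2 / (real m + 1/2)\<^sup>2)"

text \<open>
  Since \<open>cos y = sin (2 y)/(2 sin y)\<close>, this is the quotient of two sine products: in the product for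
  \<open>sin (2 \<pi> x)\<close> the factors with even index are those of \<open>sin (\<pi> x)\<close>, and the odd ones are left.
\<close>

lemma cos_prod_tendsto:
  assumes "0 < x" "x < 1"
  shows "cos_prod x \<longlonglongrightarrow> cos (pi * x)"
proof -
  define S where "S y n = (\<Prod>k=1..n. 1 - y\<^sup>2 / (real k)\<^sup>2)" for y n
  have split: "S (2 * x) (2 * n) = cos_prod x n * S x n" for n
  proof (induction n)
    case (Suc n)
    have "S (2 * x) (2 * Suc n) = S (2 * x) (2 * n)
        * (1 - (2 * x)\<^sup>2 / (real (2 * n + 1))\<^sup>2) * (1 - (2 * x)\<^sup>2 / (real (2 * n + 2))\<^sup>2)"
      by (simp add: S_def)
    also have "(2 * x)\<^sup>2 / (real (2 * n + 1))\<^sup>2 = x\<^sup>2 / (real n + 1/2)\<^sup>2"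
      unfolding power_divide[symmetric] by (intro arg_cong[of _ _ "\<lambda>t. t\<^sup>2"]) (simp add: field_simps)
    also have "(2 * x)\<^sup>2 / (real (2 * n + 2))\<^sup>2 = x\<^sup>2 / (real (Suc n))\<^sup>2"
      unfolding power_divide[symmetric] by (intro arg_cong[of _ _ "\<lambda>t. t\<^sup>2"]) (simp add: field_simps)
    also have "S (2 * x) (2 * n) = cos_prod x n * S x n" by (rule Suc.IH)
    moreover have "cos_prod x (Suc n) = cos_prod x n * (1 - x\<^sup>2 / (real n + 1/2)\<^sup>2)"
      "S x (Suc n) = S x n * (1 - x\<^sup>2 / (real (Suc n))\<^sup>2)"
      by (simp_all add: cos_prod_def S_def)
    ultimately show ?case by (simp only: mult_ac)
  qed (simp add: S_def cos_prod_def)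
  have S_lim: "(\<lambda>n. pi * y * S y n) \<longlonglongrightarrow> sin (pi * y)" for y
    unfolding S_def by (rule sin_product_formula_real)
  have sin_nz: "sin (pi * x) > 0" using assms by (intro sin_gt_zero) auto
  have S_nz: "S x n \<noteq> 0" for n
  proof -
    have "1 - x\<^sup>2 / (real k)\<^sup>2 > 0" if "k \<ge> 1" for k
    proof -
      have "x / real k < 1" using that assms by (simp add: field_simps)
      hence "(x / real k)\<^sup>2 < 1" using assms by (simp add: power_less_one_iff)
      thus ?thesis by (simp add: power_divide)
    qed
    hence "S x n > 0" unfolding S_def by (intro prod_pos) auto
    thus ?thesis by simp
  qed
  have "(\<lambda>n. pi * (2 * x) * S (2 * x) (2 * n)) \<longlonglongrightarrow> sin (pi * (2 * x))"
    using LIMSEQ_subseq_LIMSEQ[OF S_lim[of "2 * x"], of "\<lambda>n. 2 * n"]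
    by (simp add: strict_mono_def o_def)
  hence "(\<lambda>n. pi * (2 * x) * S (2 * x) (2 * n) / (2 * (pi * x * S x n)))
           \<longlonglongrightarrow> sin (pi * (2 * x)) / (2 * sin (pi * x))"
    using sin_nz by (intro tendsto_intros S_lim) auto
  moreover have "pi * (2 * x) * S (2 * x) (2 * n) / (2 * (pi * x * S x n)) = cos_prod x n" for n
    using S_nz[of n] assms by (simp add: split)
  moreover have "sin (pi * (2 * x)) / (2 * sin (pi * x)) = cos (pi * x)"
    using sin_nz sin_double[of "pi * x"] by (simp add: mult_ac)
  ultimately show ?thesis by simp
qed

lemma cos_prod_bounds:
  assumes "0 < x" "x \<le> 1/2"
  shows "0 \<le> cos_prod x M" "cos_prod x M \<le> 1"
proof -
  have "0 \<le> 1 - x\<^sup>2 / (real m + 1/2)\<^sup>2 \<and> 1 - x\<^sup>2 / (real m + 1/2)\<^sup>2 \<le> 1" for m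
  proof -
    have "x\<^sup>2 \<le> (real m + 1/2)\<^sup>2" using assms by (intro power_mono) auto
    moreover have "0 < (real m + 1/2)\<^sup>2" by (simp add: add_nonneg_pos)
    ultimately show ?thesis by (simp add: divide_simps)
  qed
  thus "0 \<le> cos_prod x M" "cos_prod x M \<le> 1"
    unfolding cos_prod_def by (auto intro: prod_nonneg prod_le_1)
qed

section \<open>Comparison of coefficients\<close>

text \<open>
  The recurrences for \<open>V\<close> and \<open>U\<close> are those of elementary symmetric functions under adjoining the
  variable \<open>1/c\<^sup>2\<close>; the last term is the part of the third symmetric function that is cut off.
\<close>

lemma quartic_step:
  fixes x c :: real
  assumes "c \<ge> 1/2"
  shows "1 - V_sum c * x\<^sup>2 + U_sum c * x ^ 4
    = (1 - x\<^sup>2 / c\<^sup>2) * (1 - V_sum (c + 1) * x\<^sup>2 + U_sum (c + 1) * x ^ 4)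
      + U_sum (c + 1) / c\<^sup>2 * x ^ 6"
  unfolding V_sum_rec[OF assms] U_sum_rec[OF assms]
  by (simp add: algebra_simps add_divide_distrib eval_nat_numeral)

text \<open>
  The errors of the iterated \<open>quartic_step\<close> are nonnegative, and they add up: each is at most
  \<open>U(1/2) x\<^sup>6/c\<^sub>m\<^sup>2\<close>, as \<open>U\<close> decreases along \<open>c\<^sub>m\<close> and the partial products lie in \<open>[0, 1]\<close>, and
  \<open>1/c\<^sub>m\<^sup>2 = V(c\<^sub>m) - V(c\<^sub>m + 1)\<close> telescopes.
\<close>

lemma cos_between:
  fixes x :: real
  assumes x: "0 < x" "x \<le> 1/2"
  defines "T \<equiv> \<lambda>c. 1 - V_sum c * x\<^sup>2 + U_sum c * x ^ 4"
  shows "cos (pi * x) \<le> T (1/2)" "T (1/2) \<le> cos (pi * x) + U_sum (1/2) * V_sum (1/2) * x ^ 6"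
proof -
  define c where "c m = real m + 1/2" for m
  have c_ge: "c m \<ge> 1/2" for m by (simp add: c_def)
  have c_Suc: "c m + 1 = c (Suc m)" and c_0: "c 0 = 1/2" for m by (simp_all add: c_def)
  have U_le: "U_sum (c m) \<le> U_sum (1/2)" for m
  proof (induction m)
    case (Suc m)
    have "0 \<le> V_sum (c (Suc m)) / (c m)\<^sup>2" using V_sum_bounds(1)[OF c_ge] by simp
    with Suc.IH U_sum_rec[OF c_ge[of m]] show ?case unfolding c_Suc by linarith
  qed (simp add: c_0)
  have sandwich: "cos_prod x M * T (c M) \<le> T (1/2) \<and>
      T (1/2) \<le> cos_prod x M * T (c M) + U_sum (1/2) * (V_sum (1/2) - V_sum (c M)) * x ^ 6" for M
  proof (induction M)
    case (Suc M)
    define e where "e = U_sum (c (Suc M)) / (c M)\<^sup>2 * x ^ 6"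
    have e: "0 \<le> e" using U_sum_bounds(1)[OF c_ge] x by (simp add: e_def)
    have "cos_prod x M * T (c M) = cos_prod x (Suc M) * T (c (Suc M)) + cos_prod x M * e"
      unfolding T_def quartic_step[OF c_ge[of M]] unfolding c_Suc e_def
      by (simp add: cos_prod_def c_def distrib_left mult.assoc)
    moreover have "0 \<le> cos_prod x M * e" "cos_prod x M * e \<le> 1 * e"
      using cos_prod_bounds[OF x, of M] e by (intro mult_nonneg_nonneg mult_right_mono; simp)+
    moreover have "e \<le> U_sum (1/2) * (V_sum (c M) - V_sum (c (Suc M))) * x ^ 6"
    proof -
      have "e = U_sum (c (Suc M)) * (V_sum (c M) - V_sum (c (Suc M))) * x ^ 6"
        using V_sum_rec[OF c_ge[of M]] by (simp add: e_def c_Suc)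
      also have "\<dots> \<le> U_sum (1/2) * (V_sum (c M) - V_sum (c (Suc M))) * x ^ 6"
        using V_sum_rec[OF c_ge[of M]] x unfolding c_Suc
        by (intro mult_right_mono U_le) auto
      finally show ?thesis .
    qed
    ultimately show ?case using Suc.IH by (simp add: algebra_simps)
  qed (simp add: c_0 cos_prod_def)
  have inv_c: "(\<lambda>m. a / c m * b) \<longlonglongrightarrow> 0" for a b unfolding c_def by real_asymp
  have V_lim: "(\<lambda>m. V_sum (c m)) \<longlonglongrightarrow> 0"
    using V_sum_bounds[OF c_ge]
    by (intro tendsto_sandwich[OF _ _ tendsto_const inv_c[of 4 "suminf majorant"]]) auto
  have U_lim: "(\<lambda>m. U_sum (c m)) \<longlonglongrightarrow> 0"
    using U_sum_bounds[OF c_ge]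
    by (intro tendsto_sandwich[OF _ _ tendsto_const inv_c[of 10 "suminf majorant"]]) auto
  have "(\<lambda>m. cos_prod x m * T (c m)) \<longlonglongrightarrow> cos (pi * x) * (1 - 0 * x\<^sup>2 + 0 * x ^ 4)"
    unfolding T_def using x by (intro tendsto_intros V_lim U_lim cos_prod_tendsto) auto
  hence lim: "(\<lambda>m. cos_prod x m * T (c m)) \<longlonglongrightarrow> cos (pi * x)" by simp
  show "cos (pi * x) \<le> T (1/2)"
    using sandwich by (intro LIMSEQ_le_const2[OF lim]) auto
  have "(\<lambda>m. cos_prod x m * T (c m) + U_sum (1/2) * (V_sum (1/2) - V_sum (c m)) * x ^ 6)
          \<longlonglongrightarrow> cos (pi * x) + U_sum (1/2) * (V_sum (1/2) - 0) * x ^ 6"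
    by (intro tendsto_intros lim V_lim)
  thus "T (1/2) \<le> cos (pi * x) + U_sum (1/2) * V_sum (1/2) * x ^ 6"
    using sandwich by (intro LIMSEQ_le_const[where X =
      "\<lambda>m. cos_prod x m * T (c m) + U_sum (1/2) * (V_sum (1/2) - V_sum (c m)) * x ^ 6"]) auto
qed

text \<open>
  An error of order \<open>x\<^sup>6\<close> vanishes after division by \<open>x\<^sup>2\<close> and by \<open>x\<^sup>4\<close>, so both coefficients agree
  with those of the cosine. The coefficient of \<open>x\<^sup>2\<close> has to be settled first for the second limit to
  be finite.
\<close>

lemma U_sum_half: "U_sum (1/2) = pi ^ 4 / 24"
proof -
  define V U where "V = V_sum (1/2)" and "U = U_sum (1/2)"
  define d where "d x = 1 - V * x\<^sup>2 + U * x ^ 4 - cos (pi * x)" for x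
  have d: "0 \<le> d x \<and> d x \<le> U * V * x ^ 6" if "0 < x" "x \<le> 1/2" for x
    using cos_between[OF that] by (simp add: d_def U_def V_def)
  have near: "eventually (\<lambda>x::real. 0 < x \<and> x \<le> 1/2) (at_right 0)"
    by (auto simp: eventually_at_right_field intro!: exI[of _ "1/2"])
  have lim: "((\<lambda>x. d x / x ^ n) \<longlongrightarrow> 0) (at_right 0)" if "n < 6" for n
  proof (rule tendsto_sandwich)
    show "eventually (\<lambda>x. 0 \<le> d x / x ^ n) (at_right 0)"
      using near by eventually_elim (use d in auto)
    show "eventually (\<lambda>x. d x / x ^ n \<le> U * V * x ^ (6 - n)) (at_right 0)"
      using near
    proof eventually_elim
      case (elim x)
      have "d x / x ^ n \<le> U * V * x ^ 6 / x ^ n" using d elim by (intro divide_right_mono) auto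
      also have "\<dots> = U * V * x ^ (6 - n)" using elim that by (simp add: power_diff)
      finally show ?case .
    qed
    show "((\<lambda>x. U * V * x ^ (6 - n)) \<longlongrightarrow> 0) (at_right 0)"
      by (rule tendsto_eq_intros refl | use that in simp)+
  qed simp
  have "((\<lambda>x. d x / x ^ 2) \<longlongrightarrow> pi * pi / 2 - V) (at_right 0)"
    unfolding d_def by real_asymp
  with lim[of 2] have "pi * pi / 2 - V = 0" by (intro tendsto_unique) auto
  hence V: "V = pi\<^sup>2 / 2" by (simp add: power2_eq_square)
  have "((\<lambda>x::real. (1 - x\<^sup>2 / 2 - cos x) / x ^ 4) \<longlongrightarrow> - (1 / 24)) (at_right 0)"
    by real_asymp
  moreover have "filterlim (\<lambda>x. pi * x) (at_right 0) (at_right 0)" by real_asymp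
  ultimately have "((\<lambda>x. (1 - (pi * x)\<^sup>2 / 2 - cos (pi * x)) / (pi * x) ^ 4) \<longlongrightarrow> - (1 / 24))
      (at_right 0)"
    by (rule filterlim_compose)
  hence "((\<lambda>x. pi ^ 4 * ((1 - (pi * x)\<^sup>2 / 2 - cos (pi * x)) / (pi * x) ^ 4) + U)
      \<longlongrightarrow> pi ^ 4 * - (1 / 24) + U) (at_right 0)"
    by (intro tendsto_intros)
  moreover have "eventually (\<lambda>x. pi ^ 4 * ((1 - (pi * x)\<^sup>2 / 2 - cos (pi * x)) / (pi * x) ^ 4) + U
      = d x / x ^ 4) (at_right 0)"
    using near
  proof eventually_elim
    case (elim x)
    thus ?case unfolding d_def V by (simp add: divide_simps eval_nat_numeral)
  qed
  ultimately have "((\<lambda>x. d x / x ^ 4) \<longlongrightarrow> pi ^ 4 * - (1 / 24) + U) (at_right 0)"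
    by (rule Lim_transform_eventually)
  with lim[of 4] have "pi ^ 4 * - (1 / 24) + U = 0" by (intro tendsto_unique) auto
  thus ?thesis by (simp add: U_def)
qed

lemma wt_half:
  "wt (1/2) i = 16 ^ Suc i / (real (Suc i) ^ 3 * real ((2 * Suc i) choose Suc i) ^ 3)"
proof -
  define k where "k = Suc i"
  have k: "real k \<noteq> 0" "pochhammer (1/2::real) k \<noteq> 0"
    using pochhammer_pos[of "1/2::real" k] by (auto simp: k_def)
  have f: "(fact k :: real) = real k * fact i" by (simp add: k_def)
  have "real ((2 * k) choose k) = fact (2 * k) / (fact k * fact k)"
    by (simp add: binomial_fact)
  also have "\<dots> = 4 ^ k * pochhammer (1/2) k / fact k"
    by (simp add: fact_double power_mult)
  finally have choose: "real ((2 * k) choose k) = 4 ^ k * pochhammer (1/2) k / (real k * fact i)"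
    by (simp add: f)
  have "(16::real) ^ k = 4 ^ k * 4 ^ k" by (simp flip: power_mult_distrib)
  thus ?thesis
    using k unfolding wt_def k_def[symmetric] choose
    by (simp add: power_divide power_mult_distrib divide_simps power2_eq_square power3_eq_cube)
qed

theorem theorem1p2:
  shows "(\<lambda>i. let k = Suc i in
            16 ^ k / (real k ^ 3 * real ((2 * k) choose k) ^ 3) *
              ((6 * real k - 2) * harm_ord 2 (k - 1) + 1 / real k))
         sums (pi ^ 4 / 24)"
proof -
  have "(let k = Suc i in
            16 ^ k / (real k ^ 3 * real ((2 * k) choose k) ^ 3) *
              ((6 * real k - 2) * harm_ord 2 (k - 1) + 1 / real k)) = U_term (1/2) i" for i
    unfolding Let_def wt_half[symmetric] U_term_def diff_Suc_1 by (simp add: algebra_simps)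
  thus ?thesis using U_term_sums[of "1/2"] by (simp add: U_sum_half del: mult_Suc_right)
qed

end
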